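(* Let $K$ be a field of characteristic $0$, let $X=\{x_1,\ldots,x_d\}$, and let $\Omega$ be a set of multilinear operations as in the context. Let $G$ be a finite subgroup of $GL_d(K)$. Then $$H(K\{X\}_{\Omega}^G,t)=\frac{1}{\vert G\vert}\sum_{g\in G}H(K\{X\}_{\Omega},\xi_1(g)t,\ldots,\xi_d(g)t),$$ where $\xi_1(g),\ldots,\xi_d(g)$ are the eigenvalues (in an algebraic closure of $K$, with multiplicity) of the $d\times d$ matrix $g\in G$.
   Context: $\Omega=\bigcup_{n\ge 2}\Omega_n$, where $\Omega_n=\{\nu_{ni}\mid i=1,\ldots,p_n\}$ is a finite set (possibly empty) of $n$-ary operation symbols. The free $\Omega$-magma $\{X\}_{\Omega}$ is the smallest set of formal expressions containing $X$ and containing $\nu_{ni}(u_1,\ldots,u_n)$ whenever $\nu_{ni}\in\Omega$ and $u_1,\ldots,u_n\in\{X\}_{\Omega}$. The (nonunitary) free $\Omega$-algebra $K\{X\}_{\Omega}$ is the $K$-vector space with basis $\{X\}_{\Omega}$, with the operations of $\Omega$ extended multilinearly. $K\{X\}_{\Omega}$ is $\mathbb{Z}$-graded by $\deg(x_j)=1$ and $\deg\nu_{ni}(u_1,\ldots,u_n)=\sum_j\deg(u_j)$, and $\mathbb{Z}^d$-graded by counting the number of occurrences of each $x_j$ in a monomial. For a graded subspace $V$, $H(V,t)=\sum_{k\ge1}\dim(V^{(k)})t^k$; for a multigraded one, $H(V,t_1,\ldots,t_d)=\sum\dim(V^{(k_1,\ldots,k_d)})t_1^{k_1}\cdots t_d^{k_d}$.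 $GL_d(K)$ acts on the vector space $KX$ with basis $X$ by $g(x_j)=\sum_{i=1}^d\alpha_{ij}x_i$ for $g=(\alpha_{ij})$, and this is extended to $K\{X\}_{\Omega}$ by $g(u(x_1,\ldots,x_d))=u(g(x_1),\ldots,g(x_d))$. $K\{X\}_{\Omega}^G=\{f\in K\{X\}_{\Omega}\mid g(f)=f\text{ for all }g\in G\}$, graded by the $\mathbb{Z}$-grading. *)

theory Defs
  imports
    "Jordan_Normal_Form.Char_Poly"
    "HOL-Algebra.Algebraic_Closure_Type"
    "HOL-Library.Poly_Mapping"
    "HOL-Computational_Algebra.Formal_Power_Series"
begin

text \<open>
  Indices are zero-based: the generators \<open>x\<^sub>1, \<dots>, x\<^sub>d\<close> are \<open>Var 0, \<dots>, Var (d - 1)\<close>,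
  matching the index convention of \<^typ>\<open>'a mat\<close>.
\<close>

datatype 'f expr = Var nat | Op 'f "'f expr list"

text \<open>
  \<open>\<Omega> n\<close> is the set of \<open>n\<close>-ary operation symbols; only the components with \<open>n \<ge> 2\<close> are used.
  Should the same symbol occur in several components, its uses with different arities are
  still different operations, since the number of arguments tells them apart.
\<close>

inductive_set free_magma :: "(nat \<Rightarrow> 'f set) \<Rightarrow> nat \<Rightarrow> 'f expr set"
  for \<Omega> :: "nat \<Rightarrow> 'f set" and d :: nat
where
  Var: "j < d \<Longrightarrow> Var j \<in> free_magma \<Omega> d"
| Op: "n \<ge> 2 \<Longrightarrow> \<nu> \<in> \<Omega> n \<Longrightarrow> length us = n \<Longrightarrow> (\<forall>u\<in>set us. u \<in> free_magma \<Omega> d)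
       \<Longrightarrow> Op \<nu> us \<in> free_magma \<Omega> d"

definition pm_scale :: "'k \<Rightarrow> ('b \<Rightarrow>\<^sub>0 'k) \<Rightarrow> ('b \<Rightarrow>\<^sub>0 'k::field)" where
  "pm_scale c f = Poly_Mapping.map ((*) c) f"

lemma lookup_pm_scale [simp]: "Poly_Mapping.lookup (pm_scale c f) u = c * Poly_Mapping.lookup f u"
  unfolding pm_scale_def by (simp add: Poly_Mapping.map.rep_eq when_def)

global_interpretation pm: vector_space "pm_scale :: 'k::field \<Rightarrow> ('b \<Rightarrow>\<^sub>0 'k) \<Rightarrow> ('b \<Rightarrow>\<^sub>0 'k)"
  by unfold_locales
     (auto intro!: poly_mapping_eqI simp: Poly_Mapping.lookup_add algebra_simps)

definition free_algebra :: "(nat \<Rightarrow> 'f set) \<Rightarrow> nat \<Rightarrow> ('f expr \<Rightarrow>\<^sub>0 'k::field) set" where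
  "free_algebra \<Omega> d = {f. Poly_Mapping.keys f \<subseteq> free_magma \<Omega> d}"

text \<open>The multilinear extension of the operation \<open>\<nu>\<close> of the magma; its arity is \<open>length fs\<close>.\<close>

definition op_alg :: "'f \<Rightarrow> ('f expr \<Rightarrow>\<^sub>0 'k) list \<Rightarrow> ('f expr \<Rightarrow>\<^sub>0 'k::field)" where
  "op_alg \<nu> fs = (\<Sum>us\<in>listset (map Poly_Mapping.keys fs).
     Poly_Mapping.single (Op \<nu> us) (\<Prod>i<length fs. Poly_Mapping.lookup (fs ! i) (us ! i)))"

text \<open>The value \<open>u(\<phi> 0, \<dots>, \<phi> (d - 1))\<close> in the free algebra, for a monomial \<open>u\<close>.\<close>

primrec subst_expr :: "(nat \<Rightarrow> ('f expr \<Rightarrow>\<^sub>0 'k)) \<Rightarrow> 'f expr \<Rightarrow> ('f expr \<Rightarrow>\<^sub>0 'k::field)" where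
  "subst_expr \<phi> (Var j) = \<phi> j"
| "subst_expr \<phi> (Op \<nu> us) = op_alg \<nu> (map (subst_expr \<phi>) us)"

definition act_gen :: "'k mat \<Rightarrow> nat \<Rightarrow> ('f expr \<Rightarrow>\<^sub>0 'k::field)" where
  "act_gen g j = (\<Sum>i<dim_row g. Poly_Mapping.single (Var i) (g $$ (i, j)))"

definition act :: "'k mat \<Rightarrow> ('f expr \<Rightarrow>\<^sub>0 'k) \<Rightarrow> ('f expr \<Rightarrow>\<^sub>0 'k::field)" where
  "act g f = (\<Sum>u\<in>Poly_Mapping.keys f.
     pm_scale (Poly_Mapping.lookup f u) (subst_expr (act_gen g) u))"

definition invariants :: "(nat \<Rightarrow> 'f set) \<Rightarrow> nat \<Rightarrow> 'k mat set \<Rightarrow> ('f expr \<Rightarrow>\<^sub>0 'k::field) set" where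
  "invariants \<Omega> d G = {f \<in> free_algebra \<Omega> d. \<forall>g\<in>G. act g f = f}"

definition GL :: "'k::field itself \<Rightarrow> nat \<Rightarrow> 'k mat monoid" where
  "GL ty d = units_of (ring_mat ty d ())"

primrec deg :: "'f expr \<Rightarrow> nat" where
  "deg (Var j) = 1"
| "deg (Op \<nu> us) = sum_list (map deg us)"

primrec occ :: "nat \<Rightarrow> 'f expr \<Rightarrow> nat" where
  "occ i (Var j) = (if i = j then 1 else 0)"
| "occ i (Op \<nu> us) = sum_list (map (occ i) us)"

definition hom_comp :: "('f expr \<Rightarrow>\<^sub>0 'k::field) set \<Rightarrow> nat \<Rightarrow> ('f expr \<Rightarrow>\<^sub>0 'k) set" where
  "hom_comp V k = {f \<in> V. \<forall>u\<in>Poly_Mapping.keys f. deg u = k}"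

text \<open>A multidegree \<open>(k\<^sub>1, \<dots>, k\<^sub>d)\<close> is represented by a list of length \<open>d\<close>.\<close>

definition multihom_comp :: "('f expr \<Rightarrow>\<^sub>0 'k::field) set \<Rightarrow> nat list \<Rightarrow> ('f expr \<Rightarrow>\<^sub>0 'k) set" where
  "multihom_comp V ks =
     {f \<in> V. \<forall>u\<in>Poly_Mapping.keys f. \<forall>i<length ks. occ i u = ks ! i}"

definition hilbert_series :: "('f expr \<Rightarrow>\<^sub>0 'k::field) set \<Rightarrow> 'c::semiring_1 fps" where
  "hilbert_series V = Abs_fps (\<lambda>k. if k \<ge> 1 then of_nat (pm.dim (hom_comp V k)) else 0)"

text \<open>
  A formal power series in \<open>d\<close> variables with coefficients in \<open>\<nat>\<close> is represented by its
  coefficient function on multidegrees, that is, on lists of length \<open>d\<close>.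
\<close>

definition multi_hilbert_series :: "('f expr \<Rightarrow>\<^sub>0 'k::field) set \<Rightarrow> nat list \<Rightarrow> nat" where
  "multi_hilbert_series V ks = pm.dim (multihom_comp V ks)"

text \<open>
  \<open>mfps_eval H [a\<^sub>1, \<dots>, a\<^sub>d]\<close> is \<open>H(a\<^sub>1, \<dots>, a\<^sub>d)\<close> for univariate power series \<open>a\<^sub>i\<close> with zero
  constant term. Then \<open>a\<^sub>1\<^sup>k\<^sup>1 \<cdots> a\<^sub>d\<^sup>k\<^sup>d\<close> has no terms of degree less than \<open>k\<^sub>1 + \<dots> + k\<^sub>d\<close>, so only
  the finitely many multidegrees of total degree at most \<open>n\<close> contribute to the coefficient
  of \<open>t\<^sup>n\<close>.
\<close>

definition mfps_eval :: "(nat list \<Rightarrow> nat) \<Rightarrow> 'c::comm_semiring_1 fps list \<Rightarrow> 'c fps" where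
  "mfps_eval H as = Abs_fps (\<lambda>n.
     \<Sum>ks | length ks = length as \<and> sum_list ks \<le> n.
       of_nat (H ks) * fps_nth (\<Prod>i<length as. (as ! i) ^ (ks ! i)) n)"

text \<open>
  The entries of \<open>es\<close> are the eigenvalues of \<open>A\<close>, repeated according to their multiplicity
  as roots of the characteristic polynomial.
\<close>

definition eigenvalue_list :: "'c::field mat \<Rightarrow> 'c list \<Rightarrow> bool" where
  "eigenvalue_list A es \<longleftrightarrow> char_poly A = (\<Prod>e\<leftarrow>es. [:- e, 1:])"

end

theory Submission
  imports Defs
begin

text \<open>
  Let \<open>V\<close> be the component of degree \<open>n\<close> of the free algebra. It has a finite basis, the
  monomials of degree \<open>n\<close>. The average of the group is a projection of \<open>V\<close> onto the
  invariants, and the trace of a projection is the image in \<open>K\<close> of the dimension of its range.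
  So the dimension of the invariants is the average of the traces of the elements \<open>g \<in> G\<close>
  on \<open>V\<close> (\<open>dim_eq_trace_of_projection\<close>, \<open>dim_invariants_eq_average_trace\<close>).

  A linear substitution only replaces leaves by linear combinations of leaves. Hence the matrix
  entry of \<open>g\<close> between two monomials of the same shape is the product of the entries of \<open>g\<close>
  over the leaves, and it is zero for different shapes. In particular the trace of \<open>g\<close> on \<open>V\<close>
  is the sum over all monomials \<open>u\<close> of degree \<open>n\<close> of the product of the \<open>g\<^sub>i\<^sub>i\<close> over the leaves
  of \<open>u\<close>. On the other side, the coefficient of \<open>t\<^sup>n\<close> in \<open>H(\<xi>\<^sub>1 t, \<dots>, \<xi>\<^sub>d t)\<close> is
  the sum of the products of the \<open>\<xi>\<^sub>i\<close> over the leaves of \<open>u\<close>, since the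
  multigraded dimensions count monomials.

  The two sums have the form \<open>\<Sum>\<^sub>u weight a u\<close>, with \<open>a\<close> the diagonal of \<open>g\<close> in the first
  and the eigenvalues of \<open>g\<close> in the second. Summing over all monomials of a fixed shape with \<open>n\<close>
  leaves gives \<open>(a\<^sub>0 + \<dots> + a\<^sub>d\<^sub>-\<^sub>1)\<^sup>n\<close>, because the labels of the leaves are independent
  (\<open>sum_weight_relabellings\<close>). So the sum depends on \<open>a\<close> only through
  \<open>a\<^sub>0 + \<dots> + a\<^sub>d\<^sub>-\<^sub>1\<close>, and it suffices that the trace of the \<open>d \<times> d\<close> matrix \<open>g\<close> is the
  sum of its eigenvalues (\<open>trace_eq_sum_eigenvalues\<close>).
\<close>

section \<open>Cartesian products of lists of sets\<close>

lemma listset_eq: "listset As = {xs. list_all2 (\<in>) xs As}"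
  by (induction As) (auto simp: set_Cons_def list_all2_Cons2)

lemma in_listset_map_iff:
  "vs \<in> listset (map F us) \<longleftrightarrow> length vs = length us \<and> (\<forall>i<length us. vs ! i \<in> F (us ! i))"
  by (auto simp: listset_eq list_all2_conv_all_nth)

lemma listset_Cons_image: "listset (A # As) = (\<lambda>(x, xs). x # xs) ` (A \<times> listset As)"
  by (auto simp: set_Cons_def)

lemma finite_listset: "(\<And>A. A \<in> set As \<Longrightarrow> finite A) \<Longrightarrow> finite (listset As)"
  by (induction As) (auto simp: listset_Cons_image simp del: listset.simps(2))

text \<open>
  Distributivity of a product of sums: it reduces sums over the children of a node
  to the individual children.
\<close>

lemma sum_prod_listset:
  fixes F :: "nat \<Rightarrow> 'b \<Rightarrow> 'c::comm_semiring_1"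
  shows "(\<Sum>xs\<in>listset As. \<Prod>i<length As. F i (xs ! i)) = (\<Prod>i<length As. \<Sum>x\<in>As ! i. F i x)"
proof (induction As arbitrary: F)
  case Nil
  show ?case by simp
next
  case (Cons A As)
  have inj: "inj_on (\<lambda>(x, xs). x # xs) (A \<times> listset As)"
    by (auto simp: inj_on_def)
  have "(\<Sum>xs\<in>listset (A # As). \<Prod>i<length (A # As). F i (xs ! i))
      = (\<Sum>x\<in>A. \<Sum>xs\<in>listset As. F 0 x * (\<Prod>i<length As. F (Suc i) (xs ! i)))"
    unfolding listset_Cons_image sum.reindex[OF inj]
    by (simp add: sum.cartesian_product prod.lessThan_Suc_shift case_prod_unfold
             del: prod.lessThan_Suc)
  also have "\<dots> = (\<Sum>x\<in>A. F 0 x) * (\<Prod>i<length As. \<Sum>x\<in>As ! i. F (Suc i) x)"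
    unfolding Cons.IH[of "\<lambda>i. F (Suc i)", symmetric] by (rule sum_product[symmetric])
  finally show ?case
    by (simp add: prod.lessThan_Suc_shift del: prod.lessThan_Suc)
qed

lemma sum_list_conv_sum_nth: "sum_list (map f us) = (\<Sum>i<length us. f (us ! i))"
  by (simp add: sum_list_sum_nth atLeast0LessThan)

lemma prod_list_conv_prod_nth: "prod_list (map f us) = (\<Prod>i<length us. f (us ! i))"
  by (simp add: prod.list_conv_set_nth atLeast0LessThan)

section \<open>Monomials, their degrees and their weights\<close>

text \<open>
  The value of a monomial under the interpretation that sends \<open>x\<^sub>j\<close> to \<open>a j\<close> and every
  operation to the product of its arguments: the product of the values at the leaves.
\<close>

primrec weight :: "(nat \<Rightarrow> 'c::comm_semiring_1) \<Rightarrow> 'f expr \<Rightarrow> 'c" where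
  "weight a (Var j) = a j"
| "weight a (Op \<nu> us) = prod_list (map (weight a) us)"

lemma weight_eq_prod_occ:
  "u \<in> free_magma \<Omega> d \<Longrightarrow> weight a u = (\<Prod>i<d. a i ^ occ i u)"
proof (induction rule: free_magma.induct)
  case (Var j)
  have "(\<Prod>i<d. a i ^ occ i (Var j)) = (\<Prod>i<d. if i = j then a i else 1)"
    by (rule prod.cong) auto
  then show ?case using Var by simp
next
  case (Op n \<nu> us)
  have "weight a (Op \<nu> us) = (\<Prod>l<length us. \<Prod>i<d. a i ^ occ i (us ! l))"
    using Op by (simp add: prod_list_conv_prod_nth)
  also have "\<dots> = (\<Prod>i<d. \<Prod>l<length us. a i ^ occ i (us ! l))"
    by (rule prod.swap)
  finally show ?case by (simp add: sum_list_conv_sum_nth power_sum)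
qed

lemma deg_eq_sum_occ: "u \<in> free_magma \<Omega> d \<Longrightarrow> deg u = (\<Sum>i<d. occ i u)"
proof (induction rule: free_magma.induct)
  case (Var j)
  then show ?case by simp
next
  case (Op n \<nu> us)
  have "deg (Op \<nu> us) = (\<Sum>l<length us. \<Sum>i<d. occ i (us ! l))"
    using Op by (simp add: sum_list_conv_sum_nth)
  also have "\<dots> = (\<Sum>i<d. \<Sum>l<length us. occ i (us ! l))"
    by (rule sum.swap)
  finally show ?case by (simp add: sum_list_conv_sum_nth)
qed

text \<open>With positive degrees, this bounds both the arity of a node and the degrees of its children.\<close>

lemma sum_list_ge_member_add_length:
  fixes f :: "'b \<Rightarrow> nat"
  shows "u \<in> set us \<Longrightarrow> (\<And>v. v \<in> set us \<Longrightarrow> f v \<ge> 1) \<Longrightarrow> f u + length us \<le> sum_list (map f us) + 1"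
proof (induction us)
  case (Cons x xs)
  have "length xs \<le> sum_list (map f xs)"
    using sum_list_mono[of xs "\<lambda>_. 1" f] Cons.prems(2) by (simp add: sum_list_triv)
  moreover have "f x \<ge> 1" using Cons.prems(2) by simp
  ultimately show ?case using Cons by (cases "u = x") force+
qed simp

lemma deg_ge_1: "u \<in> free_magma \<Omega> d \<Longrightarrow> deg u \<ge> 1"
proof (induction rule: free_magma.induct)
  case (Op n \<nu> us)
  then have "us ! 0 \<in> set us" by simp
  with Op sum_list_ge_member_add_length[of "us ! 0" us deg] show ?case by fastforce
qed simp

abbreviation monomials_of_degree :: "(nat \<Rightarrow> 'f set) \<Rightarrow> nat \<Rightarrow> nat \<Rightarrow> 'f expr set" where
  "monomials_of_degree \<Omega> d n \<equiv> {u \<in> free_magma \<Omega> d. deg u = n}"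

text \<open>
  Since all arities are at least two, the children of a node have smaller degree than the node
  and its arity is at most its degree, so finitely many operations matter in each degree.
\<close>

lemma finite_monomials_of_degree:
  assumes "\<And>m. m \<ge> 2 \<Longrightarrow> finite (\<Omega> m)"
  shows "finite (monomials_of_degree \<Omega> d n)"
proof -
  have "finite {u \<in> free_magma \<Omega> d. deg u \<le> n}"
  proof (induction n)
    case 0
    have "{u \<in> free_magma \<Omega> d. deg u \<le> 0} = {}"
      by (auto dest: deg_ge_1)
    then show ?case by (simp only: finite.emptyI)
  next
    case (Suc n)
    let ?S = "{u \<in> free_magma \<Omega> d. deg u \<le> n}"
    have "{u \<in> free_magma \<Omega> d. deg u \<le> Suc n} \<subseteq>
      Var ` {..<d} \<union> (\<Union>m\<in>{2..Suc n}. \<Union>\<nu>\<in>\<Omega> m. Op \<nu> ` {us. set us \<subseteq> ?S \<and> length us = m})"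
    proof
      fix u assume "u \<in> {u \<in> free_magma \<Omega> d. deg u \<le> Suc n}"
      then have u: "u \<in> free_magma \<Omega> d" "deg u \<le> Suc n" by auto
      from u(1) show "u \<in> Var ` {..<d} \<union>
        (\<Union>m\<in>{2..Suc n}. \<Union>\<nu>\<in>\<Omega> m. Op \<nu> ` {us. set us \<subseteq> ?S \<and> length us = m})"
      proof cases
        case (Op m \<nu> us)
        have bound: "deg v + m \<le> Suc n + 1" if "v \<in> set us" for v
        proof -
          have "deg v + length us \<le> sum_list (map deg us) + 1"
            using that Op deg_ge_1 by (intro sum_list_ge_member_add_length) blast+
          then show ?thesis using Op u(2) by simp
        qed
        have "set us \<subseteq> ?S"
        proof
          fix v assume "v \<in> set us"
          with bound[of v] Op show "v \<in> ?S" by auto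
        qed
        moreover have "m \<le> Suc n"
        proof -
          have "us ! 0 \<in> set us" using Op by simp
          with bound[of "us ! 0"] deg_ge_1[of "us ! 0" \<Omega> d] Op show ?thesis by fastforce
        qed
        ultimately have "u \<in> (\<Union>m\<in>{2..Suc n}. \<Union>\<nu>\<in>\<Omega> m. Op \<nu> ` {us. set us \<subseteq> ?S \<and> length us = m})"
          unfolding Op(1) using Op(2-4) by (intro UN_I[of m] UN_I[of \<nu>] imageI) auto
        then show ?thesis by (rule UnI2)
      qed auto
    qed
    moreover have "finite (Var ` {..<d} \<union>
      (\<Union>m\<in>{2..Suc n}. \<Union>\<nu>\<in>\<Omega> m. Op \<nu> ` {us. set us \<subseteq> ?S \<and> length us = m}))"
      using Suc.IH assms finite_lists_length_eq[OF Suc.IH] by auto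
    ultimately show ?case by (rule finite_subset)
  qed
  then show ?thesis by (rule rev_finite_subset) auto
qed

section \<open>Relabelling the leaves of a monomial\<close>

text \<open>
  The monomials of the same shape as a given one, that is, with the same operations at the
  inner nodes and arbitrary generators among \<open>x\<^sub>0, \<dots>, x\<^sub>d\<^sub>-\<^sub>1\<close> at the leaves. On the free
  magma these sets are the classes of an equivalence relation.
\<close>

primrec relabellings :: "nat \<Rightarrow> 'f expr \<Rightarrow> 'f expr set" where
  "relabellings d (Var j) = Var ` {..<d}"
| "relabellings d (Op \<nu> us) = Op \<nu> ` listset (map (relabellings d) us)"

lemma Op_in_relabellings_iff:
  "w \<in> relabellings d (Op \<nu> us) \<longleftrightarrow> (\<exists>vs. w = Op \<nu> vs \<and> length vs = length us \<and>
     (\<forall>i<length us. vs ! i \<in> relabellings d (us ! i)))"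
  unfolding relabellings.simps image_iff Bex_def in_listset_map_iff by blast

lemma finite_relabellings: "finite (relabellings d u)"
  by (induction u) (auto intro!: finite_imageI finite_listset)

lemma self_in_relabellings: "u \<in> free_magma \<Omega> d \<Longrightarrow> u \<in> relabellings d u"
  by (induction rule: free_magma.induct) (auto simp: Op_in_relabellings_iff simp del: relabellings.simps(2))

lemma relabellings_eq: "v \<in> relabellings d u \<Longrightarrow> relabellings d v = relabellings d u"
proof (induction u arbitrary: v)
  case (Op \<nu> us)
  then obtain vs where "v = Op \<nu> vs" and len: "length vs = length us"
    and vs: "\<forall>i<length us. vs ! i \<in> relabellings d (us ! i)"
    by (auto simp: Op_in_relabellings_iff simp del: relabellings.simps(2))
  moreover have "map (relabellings d) vs = map (relabellings d) us"
  proof (rule nth_equalityI)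
    fix i assume "i < length (map (relabellings d) vs)"
    with len have "i < length us" by simp
    with Op.IH[OF nth_mem, of i "vs ! i"] vs len
    show "map (relabellings d) vs ! i = map (relabellings d) us ! i" by simp
  qed (simp add: len)
  ultimately show ?case by simp
qed auto

lemma deg_relabelling: "v \<in> relabellings d u \<Longrightarrow> deg v = deg u"
proof (induction u arbitrary: v)
  case (Op \<nu> us)
  then obtain vs where vs: "v = Op \<nu> vs" "length vs = length us"
    "\<forall>i<length us. vs ! i \<in> relabellings d (us ! i)"
    by (auto simp: Op_in_relabellings_iff simp del: relabellings.simps(2))
  have "(\<Sum>i<length us. deg (vs ! i)) = (\<Sum>i<length us. deg (us ! i))"
    using Op.IH[OF nth_mem] vs by (intro sum.cong) blast+
  then show ?case using vs by (simp add: sum_list_conv_sum_nth)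
qed auto

lemma relabelling_in_free_magma:
  "u \<in> free_magma \<Omega> d \<Longrightarrow> v \<in> relabellings d u \<Longrightarrow> v \<in> free_magma \<Omega> d"
proof (induction arbitrary: v rule: free_magma.induct)
  case (Op n \<nu> us)
  then obtain vs where vs: "v = Op \<nu> vs" "length vs = length us"
    "\<forall>i<length us. vs ! i \<in> relabellings d (us ! i)"
    by (auto simp: Op_in_relabellings_iff simp del: relabellings.simps(2))
  then have "\<forall>u\<in>set vs. u \<in> free_magma \<Omega> d"
    using Op by (auto simp: set_conv_nth)
  then show ?case using Op vs by (auto intro: free_magma.Op)
qed (auto intro: free_magma.Var)

text \<open>
  The labels of the \<open>deg u\<close> leaves are chosen independently, so expanding the power on the
  right gives one term for each relabelling.
\<close>

lemma sum_weight_relabellings: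
  "(\<Sum>v\<in>relabellings d u. weight a v) = (\<Sum>j<d. a j) ^ deg u"
proof (induction u)
  case (Var j)
  then show ?case by (simp add: sum.reindex inj_on_def)
next
  case (Op \<nu> us)
  have "(\<Sum>v\<in>relabellings d (Op \<nu> us). weight a v)
      = (\<Sum>vs\<in>listset (map (relabellings d) us). \<Prod>i<length (map (relabellings d) us). weight a (vs ! i))"
    by (simp add: sum.reindex inj_on_def)
       (intro sum.cong, auto simp: in_listset_map_iff prod_list_conv_prod_nth)
  also have "\<dots> = (\<Prod>i<length us. (\<Sum>j<d. a j) ^ deg (us ! i))"
    using sum_prod_listset[of "\<lambda>_. weight a" "map (relabellings d) us"]
    by (simp add: Op.IH[OF nth_mem])
  finally show ?case by (simp add: sum_list_conv_sum_nth power_sum)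
qed

text \<open>
  The monomials of degree \<open>n\<close> fall into relabelling classes, and each class contributes
  the \<open>n\<close>-th power of \<open>a\<^sub>0 + \<dots> + a\<^sub>d\<^sub>-\<^sub>1\<close>. This lets the eigenvalues of a matrix take the
  place of its diagonal entries, which have the same sum.
\<close>

lemma sum_weight_monomials_cong:
  fixes a b :: "nat \<Rightarrow> 'c::comm_semiring_1"
  assumes fin: "finite (monomials_of_degree \<Omega> d n)"
    and eq: "(\<Sum>j<d. a j) = (\<Sum>j<d. b j)"
  shows "(\<Sum>u\<in>monomials_of_degree \<Omega> d n. weight a u) = (\<Sum>u\<in>monomials_of_degree \<Omega> d n. weight b u)"
proof -
  let ?M = "monomials_of_degree \<Omega> d n"
  let ?C = "relabellings d ` ?M"
  have "\<Union>?C = ?M"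
    using self_in_relabellings deg_relabelling relabelling_in_free_magma by blast
  moreover have "A \<inter> B = {}" if "A \<in> ?C" "B \<in> ?C" "A \<noteq> B" for A B
  proof -
    from that obtain u v where "A = relabellings d u" "B = relabellings d v" by blast
    with relabellings_eq \<open>A \<noteq> B\<close> show ?thesis by (metis disjoint_iff)
  qed
  ultimately have classes: "(\<Sum>u\<in>?M. weight c u) = (\<Sum>A\<in>?C. \<Sum>u\<in>A. weight c u)"
    for c :: "nat \<Rightarrow> 'c"
    using sum.Union_disjoint[of ?C "weight c"] finite_relabellings by (force)
  show ?thesis
    unfolding classes
  proof (rule sum.cong)
    fix A assume "A \<in> ?C"
    then obtain u where "A = relabellings d u" by blast
    then show "(\<Sum>u\<in>A. weight a u) = (\<Sum>u\<in>A. weight b u)"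
      by (simp only: sum_weight_relabellings eq)
  qed simp
qed

section \<open>The matrix of the action on monomials\<close>

text \<open>The entry in row \<open>v\<close> and column \<open>u\<close> of the infinite matrix by which \<open>g\<close> acts.\<close>

definition act_coeff :: "'k::field mat \<Rightarrow> 'f expr \<Rightarrow> 'f expr \<Rightarrow> 'k" where
  "act_coeff g v u = Poly_Mapping.lookup (subst_expr (act_gen g) u) v"

lemma lookup_act: "Poly_Mapping.lookup (act g f) v =
  (\<Sum>u\<in>Poly_Mapping.keys f. Poly_Mapping.lookup f u * act_coeff g v u)"
  by (simp add: act_def lookup_sum act_coeff_def)

lemma lookup_act_superset:
  assumes "finite S" "Poly_Mapping.keys f \<subseteq> S"
  shows "Poly_Mapping.lookup (act g f) v = (\<Sum>u\<in>S. Poly_Mapping.lookup f u * act_coeff g v u)"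
  unfolding lookup_act using assms
  by (intro sum.mono_neutral_left) (auto simp: in_keys_iff)

lemma linear_act: "Vector_Spaces.linear pm_scale pm_scale (act g)"
proof (unfold_locales)
  fix f h :: "'b expr \<Rightarrow>\<^sub>0 'a"
  let ?S = "Poly_Mapping.keys f \<union> Poly_Mapping.keys h"
  show "act g (f + h) = act g f + act g h"
  proof (rule poly_mapping_eqI)
    fix v
    have "Poly_Mapping.keys (f + h) \<subseteq> ?S" by (rule Poly_Mapping.keys_add)
    then show "Poly_Mapping.lookup (act g (f + h)) v = Poly_Mapping.lookup (act g f + act g h) v"
      by (simp add: lookup_act_superset[of ?S] Poly_Mapping.lookup_add distrib_right sum.distrib)
  qed
next
  fix c :: 'a and f :: "'b expr \<Rightarrow>\<^sub>0 'a"
  let ?S = "Poly_Mapping.keys f"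
  show "act g (pm_scale c f) = pm_scale c (act g f)"
  proof (rule poly_mapping_eqI)
    fix v
    have "Poly_Mapping.keys (pm_scale c f) \<subseteq> ?S" by (auto simp: in_keys_iff)
    then show "Poly_Mapping.lookup (act g (pm_scale c f)) v = Poly_Mapping.lookup (pm_scale c (act g f)) v"
      by (simp add: lookup_act_superset[of ?S] sum_distrib_left mult.assoc)
  qed
qed

lemma lookup_act_single: "Poly_Mapping.lookup (act g (Poly_Mapping.single u 1)) v = act_coeff g v u"
  by (simp add: lookup_act)

lemma act_coeff_Var:
  "act_coeff g v (Var j) = (case v of Var i \<Rightarrow> if i < dim_row g then g $$ (i, j) else 0 | Op _ _ \<Rightarrow> 0)"
  by (cases v) (auto simp: act_coeff_def act_gen_def lookup_sum lookup_single when_def)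

text \<open>
  Multilinear expansion produces each monomial \<open>\<nu>(v\<^sub>1, \<dots>, v\<^sub>m)\<close> from exactly one choice of
  terms, so the coefficient is multiplicative over the arguments.
\<close>

lemma act_coeff_Op:
  "act_coeff g v (Op \<nu> us) = (case v of Var _ \<Rightarrow> 0 | Op \<nu>' vs \<Rightarrow>
     if \<nu>' = \<nu> \<and> length vs = length us then \<Prod>i<length us. act_coeff g (vs ! i) (us ! i) else 0)"
proof -
  let ?fs = "map (subst_expr (act_gen g)) us"
  let ?L = "listset (map Poly_Mapping.keys ?fs)"
  let ?p = "\<lambda>ws. \<Prod>i<length us. act_coeff g (ws ! i) (us ! i)"
  have fin: "finite ?L" by (rule finite_listset) auto
  have eq: "act_coeff g v (Op \<nu> us) = (\<Sum>ws\<in>?L. if Op \<nu> ws = v then ?p ws else 0)"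
    unfolding act_coeff_def
    by (simp add: op_alg_def lookup_sum lookup_single when_def cong: if_cong)
  show ?thesis
  proof (cases v)
    case (Op \<nu>' vs)
    show ?thesis
    proof (cases "\<nu>' = \<nu> \<and> length vs = length us")
      case True
      have "act_coeff g v (Op \<nu> us) = (\<Sum>ws\<in>?L. if ws = vs then ?p ws else 0)"
        unfolding eq by (rule sum.cong) (use Op True in auto)
      also have "\<dots> = (if vs \<in> ?L then ?p vs else 0)"
        using fin by simp
      \<comment> \<open>Outside the supports of the factors the product vanishes, so no case distinction remains.\<close>
      also have "\<dots> = ?p vs"
      proof (cases "vs \<in> ?L")
        case False
        then have "\<exists>i<length us. act_coeff g (vs ! i) (us ! i) = 0"
          using True by (auto simp: listset_eq list_all2_conv_all_nth in_keys_iff act_coeff_def)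
        then have "?p vs = 0" by (intro prod_zero) auto
        with False show ?thesis by simp
      qed simp
      finally show ?thesis using Op True by simp
    next
      case False
      have "act_coeff g v (Op \<nu> us) = 0"
        unfolding eq
        by (rule sum.neutral) (use Op False in \<open>auto simp: listset_eq dest: list_all2_lengthD\<close>)
      with Op False show ?thesis by auto
    qed
  next
    case (Var i)
    then show ?thesis unfolding eq by simp
  qed
qed

text \<open>
  The action preserves the shape of a monomial, because a linear substitution replaces leaves by
  combinations of leaves. All sums over matrix entries are therefore finite.
\<close>

lemma act_coeff_nonzero_imp_relabelling:
  "act_coeff g v u \<noteq> 0 \<Longrightarrow> v \<in> relabellings (dim_row g) u"
proof (induction u arbitrary: v)
  case (Var j)
  then show ?case by (auto simp: act_coeff_Var split: expr.splits if_splits)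
next
  case (Op \<nu> us)
  then obtain vs where vs: "v = Op \<nu> vs" "length vs = length us"
    "(\<Prod>i<length us. act_coeff g (vs ! i) (us ! i)) \<noteq> 0"
    by (auto simp: act_coeff_Op split: expr.splits if_splits)
  from vs(3) have "\<forall>i<length us. act_coeff g (vs ! i) (us ! i) \<noteq> 0" by auto
  with Op.IH vs show ?case
    unfolding Op_in_relabellings_iff by auto
qed

lemma act_coeff_diagonal:
  "u \<in> free_magma \<Omega> (dim_row g) \<Longrightarrow> act_coeff g u u = weight (\<lambda>i. g $$ (i, i)) u"
proof (induction rule: free_magma.induct)
  case (Op n \<nu> us)
  then show ?case by (simp add: act_coeff_Op prod_list_conv_prod_nth)
qed (simp add: act_coeff_Var)

text \<open>
  On the leaves this is the product of matrices. It propagates to the nodes because the entries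
  are multiplicative and a sum over relabellings of a node is a product of sums over its
  children.
\<close>

lemma act_coeff_mult:
  assumes g: "g \<in> carrier_mat d d" and h: "h \<in> carrier_mat d d"
  shows "u \<in> free_magma \<Omega> d \<Longrightarrow>
    (\<Sum>v\<in>relabellings d u. act_coeff g w v * act_coeff h v u) = act_coeff (g * h) w u"
proof (induction arbitrary: w rule: free_magma.induct)
  case (Var j)
  have "(\<Sum>v\<in>relabellings d (Var j). act_coeff g w v * act_coeff h v (Var j))
      = (\<Sum>i<d. act_coeff g w (Var i) * h $$ (i, j))"
    using h by (simp add: sum.reindex inj_on_def act_coeff_Var)
  also have "\<dots> = act_coeff (g * h) w (Var j)"
    using g h Var by (auto simp: act_coeff_Var scalar_prod_def atLeast0LessThan split: expr.splits)
  finally show ?case .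
next
  case (Op n \<nu> us)
  let ?L = "listset (map (relabellings d) us)"
  have len: "length vs = length us" if "vs \<in> ?L" for vs
    using that by (simp add: in_listset_map_iff)
  have eq: "(\<Sum>v\<in>relabellings d (Op \<nu> us). act_coeff g w v * act_coeff h v (Op \<nu> us))
    = (\<Sum>vs\<in>?L. act_coeff g w (Op \<nu> vs) * (\<Prod>i<length us. act_coeff h (vs ! i) (us ! i)))"
    by (simp add: sum.reindex inj_on_def) (rule sum.cong, auto simp: act_coeff_Op len)
  show ?case
  proof (cases "\<exists>ws. w = Op \<nu> ws \<and> length ws = length us")
    case True
    then obtain ws where w: "w = Op \<nu> ws" "length ws = length us" by blast
    let ?F = "\<lambda>i v. act_coeff g (ws ! i) v * act_coeff h v (us ! i)"
    have "(\<Sum>v\<in>relabellings d (Op \<nu> us). act_coeff g w v * act_coeff h v (Op \<nu> us))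
      = (\<Sum>vs\<in>?L. \<Prod>i<length (map (relabellings d) us). ?F i (vs ! i))"
      unfolding eq by (rule sum.cong) (auto simp: act_coeff_Op len w prod.distrib)
    also have "\<dots> = (\<Prod>i<length us. act_coeff (g * h) (ws ! i) (us ! i))"
      unfolding sum_prod_listset[of ?F] using Op by simp
    finally show ?thesis by (simp add: act_coeff_Op w)
  next
    case False
    have "act_coeff g w (Op \<nu> vs) = 0" if "vs \<in> ?L" for vs
      using False len[OF that] by (auto simp: act_coeff_Op split: expr.splits)
    then have "(\<Sum>v\<in>relabellings d (Op \<nu> us). act_coeff g w v * act_coeff h v (Op \<nu> us)) = 0"
      unfolding eq by simp
    also have "\<dots> = act_coeff (g * h) w (Op \<nu> us)"
      using False by (auto simp: act_coeff_Op split: expr.splits)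
    finally show ?thesis .
  qed
qed

lemma keys_act_subset: "Poly_Mapping.keys (act g f) \<subseteq> (\<Union>u\<in>Poly_Mapping.keys f. relabellings (dim_row g) u)"
proof
  fix v assume "v \<in> Poly_Mapping.keys (act g f)"
  then have "(\<Sum>u\<in>Poly_Mapping.keys f. Poly_Mapping.lookup f u * act_coeff g v u) \<noteq> 0"
    by (simp add: in_keys_iff lookup_act)
  then obtain u where "u \<in> Poly_Mapping.keys f" "act_coeff g v u \<noteq> 0"
    by (auto elim!: sum.not_neutral_contains_not_neutral)
  then show "v \<in> (\<Union>u\<in>Poly_Mapping.keys f. relabellings (dim_row g) u)"
    using act_coeff_nonzero_imp_relabelling by blast
qed

lemma act_mult:
  assumes g: "g \<in> carrier_mat d d" and h: "h \<in> carrier_mat d d" and f: "f \<in> free_algebra \<Omega> d"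
  shows "act g (act h f) = act (g * h) f"
proof (rule poly_mapping_eqI)
  fix w
  let ?K = "Poly_Mapping.keys f"
  let ?S = "\<Union>u\<in>?K. relabellings d u"
  have fin: "finite ?S" by (simp add: finite_relabellings)
  have "Poly_Mapping.keys (act h f) \<subseteq> ?S"
    using keys_act_subset[of h f] h by simp
  then have "Poly_Mapping.lookup (act g (act h f)) w
      = (\<Sum>v\<in>?S. \<Sum>u\<in>?K. Poly_Mapping.lookup f u * act_coeff h v u * act_coeff g w v)"
    by (simp add: lookup_act_superset[OF fin] lookup_act[of h] sum_distrib_right)
  also have "\<dots> = (\<Sum>u\<in>?K. Poly_Mapping.lookup f u * (\<Sum>v\<in>?S. act_coeff g w v * act_coeff h v u))"
    by (subst sum.swap) (simp add: sum_distrib_left mult_ac)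
  also have "\<dots> = (\<Sum>u\<in>?K. Poly_Mapping.lookup f u * act_coeff (g * h) w u)"
  proof (rule sum.cong[OF refl])
    fix u assume u: "u \<in> ?K"
    have "(\<Sum>v\<in>?S. act_coeff g w v * act_coeff h v u)
        = (\<Sum>v\<in>relabellings d u. act_coeff g w v * act_coeff h v u)"
      using fin u act_coeff_nonzero_imp_relabelling[of h _ u] h
      by (intro sum.mono_neutral_right) auto
    also have "\<dots> = act_coeff (g * h) w u"
      using f u by (intro act_coeff_mult[OF g h]) (auto simp: free_algebra_def)
    finally show "Poly_Mapping.lookup f u * (\<Sum>v\<in>?S. act_coeff g w v * act_coeff h v u)
        = Poly_Mapping.lookup f u * act_coeff (g * h) w u" by simp
  qed
  finally show "Poly_Mapping.lookup (act g (act h f)) w = Poly_Mapping.lookup (act (g * h) f) w"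
    by (simp add: lookup_act)
qed

section \<open>Dimensions as traces of projections\<close>

lemma poly_mapping_eq_sum_single:
  assumes "finite M" "Poly_Mapping.keys x \<subseteq> M"
  shows "x = (\<Sum>u\<in>M. pm_scale (Poly_Mapping.lookup x u) (Poly_Mapping.single u 1))"
proof (rule poly_mapping_eqI)
  fix v
  show "Poly_Mapping.lookup x v =
    Poly_Mapping.lookup (\<Sum>u\<in>M. pm_scale (Poly_Mapping.lookup x u) (Poly_Mapping.single u 1)) v"
    using assms by (auto simp: lookup_sum lookup_single when_def if_distrib in_keys_iff
      cong: if_cong)
qed

text \<open>
  Expand each \<open>P u\<close> in a basis of the image \<open>W\<close>: the coefficient functionals turn the trace
  into the sum over the basis of the coefficient of \<open>P b = b\<close> at \<open>b\<close>, which is the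
  number of basis elements.
\<close>

lemma dim_eq_trace_of_projection:
  fixes P :: "('b \<Rightarrow>\<^sub>0 'k::field) \<Rightarrow> ('b \<Rightarrow>\<^sub>0 'k)"
  assumes M: "finite M"
    and P: "Vector_Spaces.linear pm_scale pm_scale P"
    and W: "pm.subspace W"
    and keys: "\<And>x. x \<in> W \<Longrightarrow> Poly_Mapping.keys x \<subseteq> M"
    and fixed: "\<And>x. x \<in> W \<Longrightarrow> P x = x"
    and range: "\<And>u. u \<in> M \<Longrightarrow> P (Poly_Mapping.single u 1) \<in> W"
  shows "of_nat (pm.dim W) = (\<Sum>u\<in>M. Poly_Mapping.lookup (P (Poly_Mapping.single u 1)) u)"
proof -
  interpret P: Vector_Spaces.linear pm_scale pm_scale P by (rule P)
  let ?e = "\<lambda>u. Poly_Mapping.single u (1::'k)"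
  obtain B where B: "B \<subseteq> W" "pm.independent B" "W \<subseteq> pm.span B" "card B = pm.dim W"
    by (rule pm.basis_exists)
  have "W \<subseteq> pm.span (?e ` M)"
  proof
    fix x assume "x \<in> W"
    from poly_mapping_eq_sum_single[OF M keys[OF this]] show "x \<in> pm.span (?e ` M)"
      by (metis (no_types, lifting) imageI pm.span_base pm.span_scale pm.span_sum)
  qed
  with B(1) have "B \<subseteq> pm.span (?e ` M)" by blast
  then have finB: "finite B"
    using pm.independent_span_bound[of "?e ` M" B] M B(2) by blast
  let ?r = "\<lambda>x b. pm.representation B x b"
  have Pe: "P (?e u) \<in> pm.span B" if "u \<in> M" for u
    using range[OF that] B(3) by blast
  have expand: "P (?e u) = (\<Sum>b\<in>B. pm_scale (?r (P (?e u)) b) b)" if "u \<in> M" for u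
    using pm.sum_representation_eq[OF B(2) Pe[OF that] finB subset_refl] by simp
  have "(\<Sum>u\<in>M. Poly_Mapping.lookup (P (?e u)) u)
      = (\<Sum>u\<in>M. \<Sum>b\<in>B. ?r (P (?e u)) b * Poly_Mapping.lookup b u)"
  proof (rule sum.cong[OF refl])
    fix u assume "u \<in> M"
    show "Poly_Mapping.lookup (P (?e u)) u = (\<Sum>b\<in>B. ?r (P (?e u)) b * Poly_Mapping.lookup b u)"
      by (subst expand[OF \<open>u \<in> M\<close>]) (simp add: lookup_sum)
  qed
  also have "\<dots> = (\<Sum>b\<in>B. \<Sum>u\<in>M. ?r (P (?e u)) b * Poly_Mapping.lookup b u)"
    by (rule sum.swap)
  also have "\<dots> = (\<Sum>b\<in>B. 1)"
  proof (rule sum.cong[OF refl])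
    fix b assume b: "b \<in> B"
    with B(1) have bW: "b \<in> W" by blast
    have "b = P (\<Sum>u\<in>M. pm_scale (Poly_Mapping.lookup b u) (?e u))"
      using fixed[OF bW] poly_mapping_eq_sum_single[OF M keys[OF bW]] by simp
    also have "\<dots> = (\<Sum>u\<in>M. pm_scale (Poly_Mapping.lookup b u) (P (?e u)))"
      by (simp add: P.sum P.scale)
    finally have "?r b b = ?r (\<Sum>u\<in>M. pm_scale (Poly_Mapping.lookup b u) (P (?e u))) b"
      by (rule arg_cong)
    also have "\<dots> = (\<Sum>u\<in>M. Poly_Mapping.lookup b u * ?r (P (?e u)) b)"
      using Pe by (simp add: pm.representation_sum[OF B(2)] pm.representation_scale[OF B(2)] pm.span_scale)
    also have "?r b b = 1"
      using pm.representation_basis[OF B(2) b] by simp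
    finally show "(\<Sum>u\<in>M. ?r (P (?e u)) b * Poly_Mapping.lookup b u) = 1"
      by (simp add: mult.commute)
  qed
  finally show ?thesis by (simp add: B(4))
qed

lemma subspace_supported_on:
  "pm.subspace {f :: 'b \<Rightarrow>\<^sub>0 'k::field. Poly_Mapping.keys f \<subseteq> S}"
proof (rule pm.subspaceI)
  fix f h :: "'b \<Rightarrow>\<^sub>0 'k"
  assume "f \<in> {f. Poly_Mapping.keys f \<subseteq> S}" "h \<in> {f. Poly_Mapping.keys f \<subseteq> S}"
  with Poly_Mapping.keys_add[of f h] show "f + h \<in> {f. Poly_Mapping.keys f \<subseteq> S}" by blast
qed (auto simp: in_keys_iff)

text \<open>The identity is a projection, and its trace counts the basis of monomials.\<close>

lemma dim_supported_on:
  assumes "finite S"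
  shows "pm.dim {f :: 'b \<Rightarrow>\<^sub>0 'k::field_char_0. Poly_Mapping.keys f \<subseteq> S} = card S"
proof -
  let ?W = "{f :: 'b \<Rightarrow>\<^sub>0 'k. Poly_Mapping.keys f \<subseteq> S}"
  have "Vector_Spaces.linear pm_scale pm_scale (\<lambda>f :: 'b \<Rightarrow>\<^sub>0 'k. f)"
    by unfold_locales auto
  then have "of_nat (pm.dim ?W) = (\<Sum>u\<in>S. Poly_Mapping.lookup (Poly_Mapping.single u (1::'k)) u)"
    using assms subspace_supported_on by (intro dim_eq_trace_of_projection) auto
  then have "(of_nat (pm.dim ?W) :: 'k) = of_nat (card S)" by simp
  then show ?thesis by (simp only: of_nat_eq_iff)
qed

section \<open>The trace as the sum of the eigenvalues\<close>

text \<open>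
  The two leading coefficients are computed together, since the induction for the second one
  uses the first.
\<close>

lemma coeff_prod_linear_factors:
  fixes es :: "'c::comm_ring_1 list"
  shows "Polynomial.coeff (\<Prod>e\<leftarrow>es. [:- e, 1:]) (length es) = 1"
    and "es \<noteq> [] \<Longrightarrow> Polynomial.coeff (\<Prod>e\<leftarrow>es. [:- e, 1:]) (length es - 1) = - sum_list es"
proof (induction es)
  case (Cons e es)
  {
    case 1
    have "Polynomial.degree (\<Prod>e\<leftarrow>es. [:- e, 1:]) \<le> length es"
      by (rule order_trans[OF degree_prod_list_le]) (simp add: o_def sum_list_triv)
    then have "Polynomial.coeff (\<Prod>e\<leftarrow>es. [:- e, 1:]) (Suc (length es)) = 0"
      by (intro coeff_eq_0) simp
    then show ?case using Cons.IH(1) by simp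
  next
    case 2
    then show ?case
      using Cons.IH by (cases es) (simp_all add: coeff_pCons split: nat.splits)
  }
qed simp_all

text \<open>
  In the Leibniz expansion of the characteristic polynomial of degree \<open>n\<close>, a permutation
  other than the identity moves at least two points, so its term has degree at most \<open>n - 2\<close>.
  Hence the coefficient at \<open>n - 1\<close> comes from the product of the diagonal entries.
\<close>

lemma coeff_char_poly_eq_neg_trace:
  fixes A :: "'c::idom mat"
  assumes A: "A \<in> carrier_mat n n" and n: "n \<noteq> 0"
  shows "Polynomial.coeff (char_poly A) (n - 1) = - (\<Sum>i<n. A $$ (i, i))"
proof -
  let ?M = "char_poly_matrix A"
  let ?t = "\<lambda>p. signof p * (\<Prod>i = 0..<n. ?M $$ (i, p i))"
  have entry: "?M $$ (i, j) = (if i = j then [:- A $$ (i, j), 1:] else [:- A $$ (i, j):])"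
    if "i < n" "j < n" for i j
    using A that by (auto simp: char_poly_matrix_def)
  have other: "Polynomial.coeff (?t p) (n - 1) = 0" if p: "p permutes {0..<n}" "p \<noteq> id" for p
  proof -
    from p obtain i where i: "i < n" "p i \<noteq> i"
      by (metis atLeastLessThan_iff order_refl permutes_natset_le)
    have pn: "p j < n" if "j < n" for j
      using permutes_in_image[OF p(1), of j] that by simp
    have "p (p i) \<noteq> p i" using i permutes_inj[OF p(1)] by (auto dest: injD)
    with i pn have moved: "{i, p i} \<subseteq> {j \<in> {0..<n}. p j \<noteq> j}" by auto
    have "2 = card {i, p i}" using i(2) by simp
    also have "\<dots> \<le> card {j \<in> {0..<n}. p j \<noteq> j}" using moved by (intro card_mono) auto
    finally have two: "2 \<le> card {j \<in> {0..<n}. p j \<noteq> j}" .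
    moreover have "card {j \<in> {0..<n}. p j \<noteq> j} \<le> card {0..<n}" by (intro card_mono) auto
    ultimately have "2 \<le> n" by simp
    have "Polynomial.degree (\<Prod>j = 0..<n. ?M $$ (j, p j)) \<le> (\<Sum>j = 0..<n. Polynomial.degree (?M $$ (j, p j)))"
      by (rule order_trans[OF degree_prod_sum_le]) simp_all
    also have "\<dots> = (\<Sum>j = 0..<n. if p j = j then 1 else 0)"
      by (rule sum.cong) (auto simp: entry pn)
    also have "\<dots> = card {j \<in> {0..<n}. p j = j}" by (simp add: sum.If_cases Int_def)
    also have "\<dots> = n - card {j \<in> {0..<n}. p j \<noteq> j}"
    proof -
      have "{j \<in> {0..<n}. p j = j} = {0..<n} - {j \<in> {0..<n}. p j \<noteq> j}" by auto
      moreover have "card ({0..<n} - {j \<in> {0..<n}. p j \<noteq> j}) = n - card {j \<in> {0..<n}. p j \<noteq> j}"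
        by (subst card_Diff_subset) auto
      ultimately show ?thesis by (simp only:)
    qed
    finally have "Polynomial.degree (\<Prod>j = 0..<n. ?M $$ (j, p j)) < n - 1" using two \<open>2 \<le> n\<close> by linarith
    then show ?thesis by (intro coeff_eq_0) simp
  qed
  have "char_poly A = (\<Sum>p | p permutes {0..<n}. ?t p)"
    unfolding char_poly_def using A by (intro det_def') simp
  then have "Polynomial.coeff (char_poly A) (n - 1) =
    (\<Sum>p | p permutes {0..<n}. Polynomial.coeff (?t p) (n - 1))"
    by (simp add: coeff_sum)
  also have "\<dots> = (\<Sum>p\<in>{id}. Polynomial.coeff (?t p) (n - 1))"
  proof (rule sum.mono_neutral_right)
    show "\<forall>p\<in>{p. p permutes {0..<n}} - {id}. Polynomial.coeff (?t p) (n - 1) = 0"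
      using other by blast
  qed (auto simp: finite_permutations permutes_id)
  also have "\<dots> = Polynomial.coeff (\<Prod>i = 0..<n. ?M $$ (i, i)) (n - 1)" by simp
  also have "(\<Prod>i = 0..<n. ?M $$ (i, i)) = (\<Prod>e\<leftarrow>diag_mat A. [:- e, 1:])"
    using A by (simp add: diag_mat_def prod.list_conv_set_nth entry)
  also have "Polynomial.coeff \<dots> (n - 1) = - sum_list (diag_mat A)"
    using coeff_prod_linear_factors(2)[of "diag_mat A"] A n by (auto simp: diag_mat_def)
  also have "sum_list (diag_mat A) = (\<Sum>i<n. A $$ (i, i))"
    using A by (simp add: diag_mat_def sum_list_sum_nth atLeast0LessThan)
  finally show ?thesis .
qed

lemma eigenvalue_list_length:
  assumes "A \<in> carrier_mat n n" "eigenvalue_list A es"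
  shows "length es = n"
proof -
  have "Polynomial.degree (\<Prod>e\<leftarrow>es. [:- e, 1:]) = length es"
    by (rule degree_linear_factors)
  then show ?thesis
    using degree_monic_char_poly[OF assms(1)] assms(2) by (simp add: eigenvalue_list_def)
qed

lemma trace_eq_sum_eigenvalues:
  assumes A: "A \<in> carrier_mat n n" and es: "eigenvalue_list A es"
  shows "(\<Sum>i<n. A $$ (i, i)) = sum_list es"
proof (cases "n = 0")
  case True
  then show ?thesis using eigenvalue_list_length[OF A es] by simp
next
  case False
  then show ?thesis
    using coeff_char_poly_eq_neg_trace[OF A False] coeff_prod_linear_factors(2)[of es]
      eigenvalue_list_length[OF A es] es by (auto simp: eigenvalue_list_def)
qed

section \<open>Hilbert series\<close>

lemma hom_comp_invariants_eq:
  "hom_comp (invariants \<Omega> d G) n =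
    {f. Poly_Mapping.keys f \<subseteq> monomials_of_degree \<Omega> d n} \<inter> {f. \<forall>g\<in>G. act g f = f}"
  by (auto simp: hom_comp_def invariants_def free_algebra_def)

lemma fps_nth_prod_scaled_X:
  fixes es :: "'c::comm_ring_1 list"
  assumes "length es = length ks"
  shows "fps_nth (\<Prod>i<length es. (map (\<lambda>e. fps_const e * fps_X) es ! i) ^ (ks ! i)) n =
    (if sum_list ks = n then \<Prod>i<length es. es ! i ^ (ks ! i) else 0)"
proof -
  have "(\<Prod>i<m. (fps_const (a i) * fps_X) ^ (k i)) = fps_const (\<Prod>i<m. a i ^ k i) * fps_X ^ (\<Sum>i<m. k i)"
    for a :: "nat \<Rightarrow> 'c" and k :: "nat \<Rightarrow> nat" and m
    by (induction m) (simp_all add: power_mult_distrib power_add fps_const_mult[symmetric] mult_ac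
      del: fps_const_mult)
  then have "(\<Prod>i<length es. (map (\<lambda>e. fps_const e * fps_X) es ! i) ^ (ks ! i))
    = fps_const (\<Prod>i<length es. es ! i ^ (ks ! i)) * fps_X ^ (\<Sum>i<length es. ks ! i)"
    by simp
  also have "(\<Sum>i<length es. ks ! i) = sum_list ks"
    by (simp add: sum_list_sum_nth atLeast0LessThan assms)
  finally show ?thesis by auto
qed

text \<open>
  The component of a multidegree has the monomials of this multidegree as a basis. Each of them
  has the same weight, the value of the corresponding power product at \<open>es\<close>, so the sum over
  multidegrees is the sum of the weights, grouped by multidegree.
\<close>

lemma fps_nth_mfps_eval_free_algebra:
  fixes \<Omega> :: "nat \<Rightarrow> 'f set" and es :: "'c::comm_ring_1 list"
  assumes fin: "\<And>n. finite (monomials_of_degree \<Omega> d n)"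
    and len: "length es = d"
  shows "fps_nth (mfps_eval (multi_hilbert_series (free_algebra \<Omega> d :: ('f expr \<Rightarrow>\<^sub>0 'k::field_char_0) set))
      (map (\<lambda>e. fps_const e * fps_X) es)) n
    = (\<Sum>u\<in>monomials_of_degree \<Omega> d n. weight ((!) es) u)"
proof -
  let ?H = "multi_hilbert_series (free_algebra \<Omega> d :: ('f expr \<Rightarrow>\<^sub>0 'k) set)"
  let ?M = "monomials_of_degree \<Omega> d n"
  let ?T = "{ks. length ks = d \<and> sum_list ks \<le> n}"
  let ?occs = "\<lambda>u. map (\<lambda>i. occ i u) [0..<d]"
  have sum_occs: "sum_list (?occs u) = deg u" if "u \<in> free_magma \<Omega> d" for u
    using deg_eq_sum_occ[OF that] by (simp add: sum_list_conv_sum_nth)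
  have finT: "finite ?T"
  proof (rule finite_subset)
    show "?T \<subseteq> {ks. set ks \<subseteq> {..n} \<and> length ks = d}"
      using member_le_sum_list by fastforce
    show "finite {ks. set ks \<subseteq> {..n} \<and> length ks = d}"
      by (rule finite_lists_length_eq) simp
  qed
  have coeff: "of_nat (?H ks) *
      fps_nth (\<Prod>i<d. (map (\<lambda>e. fps_const e * fps_X) es ! i) ^ (ks ! i)) n
      = (\<Sum>u | u \<in> ?M \<and> ?occs u = ks. weight ((!) es) u)" if ks: "ks \<in> ?T" for ks
  proof (cases "sum_list ks = n")
    case True
    let ?S = "{u \<in> ?M. ?occs u = ks}"
    have occs_iff: "?occs u = ks \<longleftrightarrow> (\<forall>i<d. occ i u = ks ! i)" for u
      using ks by (auto simp: list_eq_iff_nth_eq)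
    have S: "?S = {u \<in> free_magma \<Omega> d. \<forall>i<d. occ i u = ks ! i}"
      using True sum_occs by (auto simp: occs_iff[symmetric])
    have "multihom_comp (free_algebra \<Omega> d) ks = {f :: 'f expr \<Rightarrow>\<^sub>0 'k. Poly_Mapping.keys f \<subseteq> ?S}"
      unfolding S using ks by (auto simp: multihom_comp_def free_algebra_def)
    moreover have "finite ?S" by (rule finite_subset[OF _ fin[of n]]) blast
    ultimately have "?H ks = card ?S"
      by (simp add: multi_hilbert_series_def dim_supported_on)
    moreover have "weight ((!) es) u = (\<Prod>i<d. es ! i ^ (ks ! i))" if "u \<in> ?S" for u
      using that unfolding S by (auto simp: weight_eq_prod_occ)
    ultimately show ?thesis
      using fps_nth_prod_scaled_X[of es ks n] ks len True by simp
  next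
    case False
    then have empty: "{u. u \<in> ?M \<and> ?occs u = ks} = {}" using sum_occs by auto
    show ?thesis
      unfolding empty using fps_nth_prod_scaled_X[of es ks n] ks len False by simp
  qed
  have "fps_nth (mfps_eval ?H (map (\<lambda>e. fps_const e * fps_X) es)) n
      = (\<Sum>ks\<in>?T. \<Sum>u | u \<in> ?M \<and> ?occs u = ks. weight ((!) es) u)"
    unfolding mfps_eval_def fps_nth_Abs_fps length_map len
    by (rule sum.cong[OF refl coeff])
  also have "\<dots> = (\<Sum>u\<in>?M. weight ((!) es) u)"
  proof (rule sum.group[OF fin finT])
    show "?occs ` ?M \<subseteq> ?T" using sum_occs by auto
  qed
  finally show ?thesis .
qed

lemma to_ac_weight: "to_ac (weight a u) = weight (\<lambda>i. to_ac (a i)) u"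
  by (induction u) (simp_all add: prod_list_conv_prod_nth to_ac_prod)

lemma GL_subgroup_carrier:
  assumes "subgroup G (GL TYPE('k::field) d)" "g \<in> G"
  shows "g \<in> carrier_mat d d"
  using subgroup.mem_carrier[OF assms]
  by (simp add: GL_def units_of_carrier Units_def ring_mat_def)

text \<open>
  The average over the group fixes the invariants, and its values are invariant because
  multiplication by an element permutes the group. So it is a projection onto the invariants,
  and its trace, the average of the traces of the group elements, is their dimension.
\<close>

lemma dim_invariants_eq_average_trace:
  fixes \<Omega> :: "nat \<Rightarrow> 'f set" and G :: "'k::field_char_0 mat set"
  assumes fin: "finite (monomials_of_degree \<Omega> d n)"
    and G: "subgroup G (GL TYPE('k) d)" and finG: "finite G"
  shows "of_nat (pm.dim (hom_comp (invariants \<Omega> d G) n)) =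
    (1 / of_nat (card G)) *
      (\<Sum>g\<in>G. \<Sum>u\<in>monomials_of_degree \<Omega> d n. weight (\<lambda>i. g $$ (i, i)) u)"
proof -
  let ?M = "monomials_of_degree \<Omega> d n"
  let ?W = "hom_comp (invariants \<Omega> d G) n :: ('f expr \<Rightarrow>\<^sub>0 'k) set"
  let ?c = "1 / of_nat (card G) :: 'k"
  let ?e = "\<lambda>u :: 'f expr. Poly_Mapping.single u (1::'k)"
  define P where "P = (\<lambda>f :: 'f expr \<Rightarrow>\<^sub>0 'k. pm_scale ?c (\<Sum>g\<in>G. act g f))"
  note carrier = GL_subgroup_carrier[OF G]
  have mult_closed: "g * h \<in> G" if "g \<in> G" "h \<in> G" for g h
    using subgroup.m_closed[OF G that] by (simp add: GL_def units_of_mult ring_mat_def)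
  have "monoid (ring_mat TYPE('k) d ())"
    by (rule ring.is_monoid) (rule ring_mat)
  then have cancel: "g = g'" if "h * g = h * g'" "h \<in> G" "g \<in> G" "g' \<in> G" for h g g'
    using monoid.Units_l_cancel[of "ring_mat TYPE('k) d ()" h g g'] subgroup.mem_carrier[OF G] that carrier
    by (simp add: GL_def units_of_carrier ring_mat_simps)
  have translate: "(*) h ` G = G" if "h \<in> G" for h
    using finG mult_closed cancel that by (intro endo_inj_surj) (auto simp: inj_on_def)
  have "G \<noteq> {}" using subgroup.one_closed[OF G] by blast
  with finG have card: "of_nat (card G) \<noteq> (0::'k)" by simp
  interpret act: Vector_Spaces.linear pm_scale pm_scale
    "act g :: ('f expr \<Rightarrow>\<^sub>0 'k) \<Rightarrow> ('f expr \<Rightarrow>\<^sub>0 'k)" for g :: "'k mat"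
    by (rule linear_act)
  have supp: "Poly_Mapping.keys (act g f) \<subseteq> ?M" if "g \<in> G" "Poly_Mapping.keys f \<subseteq> ?M"
    for g and f :: "'f expr \<Rightarrow>\<^sub>0 'k"
    using keys_act_subset[of g f] carrier[OF that(1)] that(2) deg_relabelling relabelling_in_free_magma
    by fastforce
  have "of_nat (pm.dim ?W) = (\<Sum>u\<in>?M. Poly_Mapping.lookup (P (?e u)) u)"
  proof (rule dim_eq_trace_of_projection[OF fin])
    show "Vector_Spaces.linear pm_scale pm_scale P"
      by unfold_locales
        (simp_all add: P_def act.add act.scale sum.distrib pm.scale_right_distrib
          pm.scale_sum_right[symmetric] mult.commute)
    have "pm.subspace {f :: 'f expr \<Rightarrow>\<^sub>0 'k. \<forall>g\<in>G. act g f = f}"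
      by (rule pm.subspaceI) (auto simp: act.zero act.add act.scale)
    then show "pm.subspace ?W"
      unfolding hom_comp_invariants_eq
      by (intro pm.subspace_inter subspace_supported_on)
    show "Poly_Mapping.keys x \<subseteq> ?M" if "x \<in> ?W" for x
      using that unfolding hom_comp_invariants_eq by blast
    show "P x = x" if "x \<in> ?W" for x
    proof -
      have "(\<Sum>g\<in>G. act g x) = (\<Sum>g\<in>G. x)"
        using that unfolding hom_comp_invariants_eq by (intro sum.cong) auto
      then show ?thesis
        using card by (intro poly_mapping_eqI) (simp add: P_def lookup_sum)
    qed
    show "P (?e u) \<in> ?W" if u: "u \<in> ?M" for u
    proof -
      have free: "?e u \<in> free_algebra \<Omega> d" using u by (simp add: free_algebra_def)
      have "act h (P (?e u)) = P (?e u)" if h: "h \<in> G" for h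
      proof -
        have "act h (P (?e u)) = pm_scale ?c (\<Sum>g\<in>G. act (h * g) (?e u))"
          unfolding P_def act.scale act.sum using act_mult[OF carrier carrier free] h by simp
        also have "(\<Sum>g\<in>G. act (h * g) (?e u)) = (\<Sum>g\<in>(*) h ` G. act g (?e u))"
          using cancel h by (subst sum.reindex) (auto simp: inj_on_def)
        finally show ?thesis by (simp add: translate[OF h] P_def)
      qed
      moreover have "Poly_Mapping.keys (P (?e u)) \<subseteq> ?M"
      proof -
        have "Poly_Mapping.lookup (P (?e u)) v = 0" if "v \<notin> ?M" for v
        proof -
          have "Poly_Mapping.lookup (act g (?e u)) v = 0" if "g \<in> G" for g
            using supp[OF that, of "?e u"] u \<open>v \<notin> ?M\<close> by (auto simp: in_keys_iff)
          then show ?thesis by (simp add: P_def lookup_sum)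
        qed
        then show ?thesis unfolding subset_iff in_keys_iff by blast
      qed
      ultimately show ?thesis unfolding hom_comp_invariants_eq by blast
    qed
  qed
  also have "\<dots> = ?c * (\<Sum>u\<in>?M. \<Sum>g\<in>G. act_coeff g u u)"
    by (simp add: P_def lookup_sum lookup_act_single sum_distrib_left)
  also have "(\<Sum>u\<in>?M. \<Sum>g\<in>G. act_coeff g u u) = (\<Sum>g\<in>G. \<Sum>u\<in>?M. act_coeff g u u)"
    by (rule sum.swap)
  also have "\<dots> = (\<Sum>g\<in>G. \<Sum>u\<in>?M. weight (\<lambda>i. g $$ (i, i)) u)"
  proof (intro sum.cong refl)
    fix g u assume "g \<in> G" "u \<in> ?M"
    with carrier show "act_coeff g u u = weight (\<lambda>i. g $$ (i, i)) u"
      by (intro act_coeff_diagonal[of _ \<Omega>]) auto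
  qed
  finally show ?thesis .
qed

section \<open>The Hilbert series of the invariants\<close>

theorem proposition4p7:
  fixes \<Omega> :: "nat \<Rightarrow> 'f set"
    and d :: nat
    and G :: "'k::field_char_0 mat set"
    and \<xi> :: "'k mat \<Rightarrow> 'k alg_closure list"
  assumes "\<And>n. n \<ge> 2 \<Longrightarrow> finite (\<Omega> n)"
    and "subgroup G (GL TYPE('k) d)"
    and "finite G"
    and "\<And>g. g \<in> G \<Longrightarrow> eigenvalue_list (map_mat to_ac g) (\<xi> g)"
  shows "hilbert_series (invariants \<Omega> d G) =
    fps_const (1 / of_nat (card G)) *
    (\<Sum>g\<in>G. mfps_eval (multi_hilbert_series (free_algebra \<Omega> d :: ('f expr \<Rightarrow>\<^sub>0 'k) set))
               (map (\<lambda>e. fps_const e * fps_X) (\<xi> g)))"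
proof (rule fps_ext)
  fix n
  let ?M = "monomials_of_degree \<Omega> d n"
  have fin: "finite (monomials_of_degree \<Omega> d m)" for m
    using assms(1) by (rule finite_monomials_of_degree)
  note carrier = GL_subgroup_carrier[OF assms(2)]
  have trace: "to_ac (\<Sum>u\<in>?M. weight (\<lambda>i. g $$ (i, i)) u) = (\<Sum>u\<in>?M. weight ((!) (\<xi> g)) u)"
    and len: "length (\<xi> g) = d" if g: "g \<in> G" for g
  proof -
    have A: "map_mat to_ac g \<in> carrier_mat d d" using carrier[OF g] by simp
    show "length (\<xi> g) = d" by (rule eigenvalue_list_length[OF A assms(4)[OF g]])
    then have "(\<Sum>i<d. to_ac (g $$ (i, i))) = (\<Sum>i<d. \<xi> g ! i)"
      using trace_eq_sum_eigenvalues[OF A assms(4)[OF g]] carrier[OF g]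
      by (simp add: sum_list_sum_nth atLeast0LessThan)
    then show "to_ac (\<Sum>u\<in>?M. weight (\<lambda>i. g $$ (i, i)) u) = (\<Sum>u\<in>?M. weight ((!) (\<xi> g)) u)"
      unfolding to_ac_sum to_ac_weight by (rule sum_weight_monomials_cong[OF fin])
  qed
  have dim: "of_nat (pm.dim (hom_comp (invariants \<Omega> d G) n)) =
      1 / of_nat (card G) * (\<Sum>g\<in>G. \<Sum>u\<in>?M. weight ((!) (\<xi> g)) u)"
  proof -
    have "(of_nat (pm.dim (hom_comp (invariants \<Omega> d G) n)) :: 'k alg_closure)
        = to_ac (of_nat (pm.dim (hom_comp (invariants \<Omega> d G) n)))" by simp
    also have "\<dots> = 1 / of_nat (card G) * (\<Sum>g\<in>G. to_ac (\<Sum>u\<in>?M. weight (\<lambda>i. g $$ (i, i)) u))"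
      unfolding dim_invariants_eq_average_trace[OF fin assms(2,3)] by (simp add: to_ac_sum)
    finally show ?thesis using trace by simp
  qed
  have rhs: "fps_nth (fps_const (1 / of_nat (card G)) *
      (\<Sum>g\<in>G. mfps_eval (multi_hilbert_series (free_algebra \<Omega> d :: ('f expr \<Rightarrow>\<^sub>0 'k) set))
               (map (\<lambda>e. fps_const e * fps_X) (\<xi> g)))) n
    = 1 / of_nat (card G) * (\<Sum>g\<in>G. \<Sum>u\<in>?M. weight ((!) (\<xi> g)) u)"
    by (simp add: fps_sum_nth fps_nth_mfps_eval_free_algebra[OF fin len])
  show "fps_nth (hilbert_series (invariants \<Omega> d G)) n =
    fps_nth (fps_const (1 / of_nat (card G)) *
      (\<Sum>g\<in>G. mfps_eval (multi_hilbert_series (free_algebra \<Omega> d :: ('f expr \<Rightarrow>\<^sub>0 'k) set))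
               (map (\<lambda>e. fps_const e * fps_X) (\<xi> g)))) n"
    \<comment> \<open>The series on the left has no constant term by definition; the one on the right has none
        because every monomial has positive degree.\<close>
  proof (cases "n = 0")
    case True
    then have "?M = {}" by (auto dest: deg_ge_1)
    then show ?thesis using True unfolding rhs by (simp only: hilbert_series_def) simp
  next
    case False
    then show ?thesis unfolding rhs dim[symmetric] by (simp add: hilbert_series_def)
  qed
qed

end
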